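(* Let $\mathcal{H}$ be a separable Hilbert space, let $W=\{(W_i,\omega_i)\}_{i\in I}$ be a Bessel fusion sequence in $\mathcal{H}$ and let $K\in B(\mathcal{H})$ be an operator with closed range. Then the following are equivalent: (i) $W$ is a $K$-fusion frame for $\mathcal{H}$; (ii) there exists a number $A>0$ such that $S_W\ge A\,KK^*$ (in the usual order on self-adjoint operators).
   Context: $I$ is a countable index set; $B(\mathcal{H})$ denotes the bounded linear operators on $\mathcal{H}$. For closed subspaces $W_i\subseteq\mathcal{H}$ and weights $\omega_i>0$ ($i\in I$), $\pi_{W_i}$ is the orthogonal projection onto $W_i$. $\{(W_i,\omega_i)\}_{i\in I}$ is a Bessel fusion sequence if there is $B<\infty$ with $\sum_{i\in I}\omega_i^2\|\pi_{W_i}f\|^2\le B\|f\|^2$ for all $f\in\mathcal{H}$. It is a $K$-fusion frame for $\mathcal{H}$ if there are constants $0<A,B<\infty$ with $A\|K^*f\|^2\le\sum_{i\in I}\omega_i^2\|\pi_{W_i}f\|^2\le B\|f\|^2$ for all $f\in\mathcal{H}$. For a Bessel fusion sequence, $S_Wf=\sum_{i\in I}\omega_i^2\pi_{W_i}f$. *)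

theory Defs
  imports "HOL-Analysis.Analysis" "HOL-Library.Nonpos_Ints"
begin

text \<open>
  The scalar field of a Hilbert space is the field of real or of complex numbers. The following
  class treats both at once; by the Gelfand-Mazur theorem it has no other members.
\<close>

class rc_scalar = real_normed_field +
  fixes sconj :: "'a \<Rightarrow> 'a"
  assumes sconj_add: "sconj (a + b) = sconj a + sconj b"
    and sconj_mult: "sconj (a * b) = sconj a * sconj b"
    and sconj_scaleR: "sconj (r *\<^sub>R 1) = r *\<^sub>R 1"
    and sconj_sconj: "sconj (sconj a) = a"
    and mult_sconj: "a * sconj a = (norm a)\<^sup>2 *\<^sub>R 1"

instantiation real :: rc_scalar
begin
definition sconj_real :: "real \<Rightarrow> real" where "sconj_real a = a"
instance by standard (simp_all add: sconj_real_def power2_eq_square)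
end

instantiation complex :: rc_scalar
begin
definition sconj_complex :: "complex \<Rightarrow> complex" where "sconj_complex = cnj"
instance
  by standard
    (simp_all add: sconj_complex_def scaleR_conv_of_real complex_norm_square[symmetric]
      del: of_real_power)
end

text \<open>
  The vectors form a Banach space whose norm is induced by the inner product \<open>ip\<close>, which is linear
  in the first argument. The axiom \<open>smul_of_real\<close> says that the real scalar multiplication of the
  type class is the restriction of \<open>smul\<close>.
\<close>

locale hilbert_space = vector_space smul
  for smul :: "'k::rc_scalar \<Rightarrow> 'a::banach \<Rightarrow> 'a" +
  fixes ip :: "'a \<Rightarrow> 'a \<Rightarrow> 'k"
  assumes smul_of_real: "smul (of_real r) x = r *\<^sub>R x"
    and ip_add_left: "ip (x + y) z = ip x z + ip y z"
    and ip_smul_left: "ip (smul c x) y = c * ip x y"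
    and ip_sconj: "ip y x = sconj (ip x y)"
    and ip_self: "ip x x = of_real ((norm x)\<^sup>2)"

lemma hilbert_space_real_inner:
  "hilbert_space scaleR (inner :: 'a::{real_inner,banach} \<Rightarrow> 'a \<Rightarrow> real)"
  by unfold_locales
    (simp_all add: algebra_simps sconj_real_def inner_commute power2_norm_eq_inner)

lemma hilbert_space_complex: "hilbert_space (*) (\<lambda>x y. x * cnj y)"
  by unfold_locales
    (simp_all add: algebra_simps sconj_complex_def scaleR_conv_of_real complex_norm_square[symmetric]
      del: of_real_power)

definition bounded_op :: "('k::rc_scalar \<Rightarrow> 'a::banach \<Rightarrow> 'a) \<Rightarrow> ('a \<Rightarrow> 'a) \<Rightarrow> bool"
  where "bounded_op smul T \<longleftrightarrow> Vector_Spaces.linear smul smul T \<and> bounded_linear T"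

definition hadjoint :: "('a::banach \<Rightarrow> 'a \<Rightarrow> 'k::rc_scalar) \<Rightarrow> ('a \<Rightarrow> 'a) \<Rightarrow> ('a \<Rightarrow> 'a)"
  where "hadjoint ip T = (THE T'. \<forall>x y. ip (T x) y = ip x (T' y))"

definition self_adjoint ::
    "('k::rc_scalar \<Rightarrow> 'a::banach \<Rightarrow> 'a) \<Rightarrow> ('a \<Rightarrow> 'a \<Rightarrow> 'k) \<Rightarrow> ('a \<Rightarrow> 'a) \<Rightarrow> bool"
  where "self_adjoint smul ip T \<longleftrightarrow> bounded_op smul T \<and> hadjoint ip T = T"

text \<open>
  The usual (Loewner) order: \<open>T - S\<close> is a positive operator. Both operators are required to be
  bounded and self-adjoint.
\<close>

definition op_le ::
    "('k::rc_scalar \<Rightarrow> 'a::banach \<Rightarrow> 'a) \<Rightarrow> ('a \<Rightarrow> 'a \<Rightarrow> 'k) \<Rightarrow> ('a \<Rightarrow> 'a) \<Rightarrow> ('a \<Rightarrow> 'a) \<Rightarrow> bool"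
  where "op_le smul ip S T \<longleftrightarrow>
    self_adjoint smul ip S \<and> self_adjoint smul ip T \<and> (\<forall>f. ip (T f - S f) f \<in> \<real>\<^sub>\<ge>\<^sub>0)"

definition closed_subspace :: "('k::rc_scalar \<Rightarrow> 'a::banach \<Rightarrow> 'a) \<Rightarrow> 'a set \<Rightarrow> bool"
  where "closed_subspace smul V \<longleftrightarrow> module.subspace smul V \<and> closed V"

definition orth_proj :: "('a::banach \<Rightarrow> 'a \<Rightarrow> 'k::rc_scalar) \<Rightarrow> 'a set \<Rightarrow> 'a \<Rightarrow> 'a"
  where "orth_proj ip V f = (THE p. p \<in> V \<and> (\<forall>v\<in>V. ip (f - p) v = 0))"

text \<open>
  An infinite sum \<^const>\<open>infsum\<close> that does not converge has value 0, hence the explicit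
  summability conditions.
\<close>

definition bessel_fusion_sequence ::
    "('k::rc_scalar \<Rightarrow> 'a::banach \<Rightarrow> 'a) \<Rightarrow> ('a \<Rightarrow> 'a \<Rightarrow> 'k) \<Rightarrow>
      'i set \<Rightarrow> ('i \<Rightarrow> 'a set) \<Rightarrow> ('i \<Rightarrow> real) \<Rightarrow> bool"
  where "bessel_fusion_sequence smul ip I W \<omega> \<longleftrightarrow>
    (\<forall>i\<in>I. closed_subspace smul (W i) \<and> \<omega> i > 0) \<and>
    (\<exists>B::real. \<forall>f.
      (\<lambda>i. (\<omega> i)\<^sup>2 * (norm (orth_proj ip (W i) f))\<^sup>2) summable_on I \<and>
      (\<Sum>\<^sub>\<infinity>i\<in>I. (\<omega> i)\<^sup>2 * (norm (orth_proj ip (W i) f))\<^sup>2) \<le> B * (norm f)\<^sup>2)"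

definition K_fusion_frame ::
    "('k::rc_scalar \<Rightarrow> 'a::banach \<Rightarrow> 'a) \<Rightarrow> ('a \<Rightarrow> 'a \<Rightarrow> 'k) \<Rightarrow> ('a \<Rightarrow> 'a) \<Rightarrow>
      'i set \<Rightarrow> ('i \<Rightarrow> 'a set) \<Rightarrow> ('i \<Rightarrow> real) \<Rightarrow> bool"
  where "K_fusion_frame smul ip K I W \<omega> \<longleftrightarrow>
    (\<forall>i\<in>I. closed_subspace smul (W i) \<and> \<omega> i > 0) \<and>
    (\<exists>A B::real. A > 0 \<and> B > 0 \<and> (\<forall>f.
      (\<lambda>i. (\<omega> i)\<^sup>2 * (norm (orth_proj ip (W i) f))\<^sup>2) summable_on I \<and>
      A * (norm (hadjoint ip K f))\<^sup>2 \<le> (\<Sum>\<^sub>\<infinity>i\<in>I. (\<omega> i)\<^sup>2 * (norm (orth_proj ip (W i) f))\<^sup>2) \<and>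
      (\<Sum>\<^sub>\<infinity>i\<in>I. (\<omega> i)\<^sup>2 * (norm (orth_proj ip (W i) f))\<^sup>2) \<le> B * (norm f)\<^sup>2))"

definition fusion_frame_op ::
    "('a::banach \<Rightarrow> 'a \<Rightarrow> 'k::rc_scalar) \<Rightarrow> 'i set \<Rightarrow> ('i \<Rightarrow> 'a set) \<Rightarrow> ('i \<Rightarrow> real) \<Rightarrow> 'a \<Rightarrow> 'a"
  where "fusion_frame_op ip I W \<omega> f = (\<Sum>\<^sub>\<infinity>i\<in>I. (\<omega> i)\<^sup>2 *\<^sub>R orth_proj ip (W i) f)"

end

theory Submission
  imports Defs
begin

text \<open>
  The quadratic form of \<open>f \<mapsto> A *\<^sub>R K (hadjoint ip K f)\<close> at \<open>f\<close> is \<open>A * (norm (hadjoint ip K f))\<^sup>2\<close>,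
  and the quadratic form of the frame operator at \<open>f\<close> is the sum of the
  \<open>(\<omega> i)\<^sup>2 * (norm (orth_proj ip (W i) f))\<^sup>2\<close>, because orthogonal projections are idempotent
  and self-adjoint. Hence the operator inequality is the lower frame inequality with the same constant \<open>A\<close>
  (\<open>op_le_fusion_frame_op_iff\<close>); the upper one is the Bessel bound.

  What has to be established is that the operators exist and are self-adjoint. Orthogonal
  projections exist because a closed subspace contains a closest point to every vector
  (\<open>closest_point_in_closed_subspace_exists\<close>), and adjoints exist by the Riesz representation
  theorem. The series of the frame operator need not converge absolutely; it converges because the
  Bessel bound controls the norm of each finite partial sum by the corresponding partial sum of
  squares (\<open>norm_sum_weighted_proj_sq_le\<close>), which is the tail estimate that
  \<open>summable_on_if_sum_norm_sq_le\<close> needs.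
\<close>

section \<open>Conjugation and the inner product\<close>

lemma sconj_of_real [simp]: "sconj (of_real r) = of_real r"
  by (simp add: of_real_def sconj_scaleR)

lemma sconj_0 [simp]: "sconj 0 = 0"
  using sconj_of_real[of 0] by simp

lemma mult_sconj_of_real: "a * sconj a = of_real ((norm a)\<^sup>2)"
  by (simp only: mult_sconj of_real_def)

lemma norm_sconj [simp]: "norm (sconj a) = norm a"
proof (cases "a = 0")
  case False
  have "norm a * norm (sconj a) = norm (of_real ((norm a)\<^sup>2) :: 'a)"
    by (metis mult_sconj_of_real norm_mult)
  also have "\<dots> = norm a * norm a"
    by (simp only: norm_of_real) (simp add: power2_eq_square)
  finally show ?thesis using False by simp
qed simp

context hilbert_space
begin

lemma ip_add_right: "ip x (y + z) = ip x y + ip x z"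
  by (metis ip_add_left ip_sconj sconj_add)

lemma ip_smul_right: "ip x (smul c y) = sconj c * ip x y"
  by (metis ip_smul_left ip_sconj sconj_mult)

lemma ip_scaleR_left: "ip (r *\<^sub>R x) y = of_real r * ip x y"
  by (metis ip_smul_left smul_of_real)

lemma ip_scaleR_right: "ip x (r *\<^sub>R y) = of_real r * ip x y"
  by (metis ip_smul_right smul_of_real sconj_of_real)

lemma ip_zero_left [simp]: "ip 0 y = 0"
  using ip_scaleR_left[of 0 0 y] by simp

lemma ip_zero_right [simp]: "ip x 0 = 0"
  using ip_scaleR_right[of x 0 0] by simp

lemma ip_diff_left: "ip (x - y) z = ip x z - ip y z"
  by (metis ip_add_left add_diff_cancel diff_add_cancel)

lemma ip_diff_right: "ip x (y - z) = ip x y - ip x z"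
  by (metis ip_add_right add_diff_cancel diff_add_cancel)

lemma ip_sum_left: "ip (\<Sum>i\<in>F. g i) y = (\<Sum>i\<in>F. ip (g i) y)"
  by (induction F rule: infinite_finite_induct) (simp_all add: ip_add_left)

lemma ip_self_eq_0_iff: "ip x x = 0 \<longleftrightarrow> x = 0"
  by (simp add: ip_self)

lemma ip_eq_0_commute: "ip x y = 0 \<Longrightarrow> ip y x = 0"
  by (subst ip_sconj) simp

lemma ip_right_eqI:
  assumes "\<And>x. ip x y = ip x z"
  shows "y = z"
  using assms[of "y - z"] ip_self_eq_0_iff[of "y - z"] by (simp add: ip_diff_right)

text \<open>
  The coefficient is that of the component of \<open>x\<close> along \<open>y\<close>; removing this component shortens
  \<open>x\<close> as computed here. The formula yields the Cauchy-Schwarz inequality, since the left-hand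
  side is nonnegative, and the orthogonality of a shortest difference to a subspace. For \<open>y = 0\<close>
  both quotients are \<open>0\<close>.
\<close>

lemma norm_minus_component:
  "(norm (x - smul (ip x y / of_real ((norm y)\<^sup>2)) y))\<^sup>2 = (norm x)\<^sup>2 - (norm (ip x y))\<^sup>2 / (norm y)\<^sup>2"
proof (cases "y = 0")
  case False
  define c where "c = ip x y / of_real ((norm y)\<^sup>2)"
  have c: "c * of_real ((norm y)\<^sup>2) = ip x y"
    using False by (simp add: c_def)
  have "c * ip y x = (ip x y * sconj (ip x y)) / of_real ((norm y)\<^sup>2)"
    by (subst ip_sconj) (simp add: c_def)
  then have cross: "c * ip y x = of_real ((norm (ip x y))\<^sup>2 / (norm y)\<^sup>2)"
    by (simp only: mult_sconj_of_real of_real_divide)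
  have "ip (x - smul c y) (x - smul c y)
      = ip x x - c * ip y x - sconj c * (ip x y - c * ip y y)"
    by (simp add: ip_diff_left ip_diff_right ip_smul_left ip_smul_right algebra_simps)
  also have "\<dots> = of_real ((norm x)\<^sup>2 - (norm (ip x y))\<^sup>2 / (norm y)\<^sup>2)"
    using c by (simp only: cross ip_self) simp
  finally have "(of_real ((norm (x - smul c y))\<^sup>2) :: 'k)
      = of_real ((norm x)\<^sup>2 - (norm (ip x y))\<^sup>2 / (norm y)\<^sup>2)"
    by (simp only: ip_self)
  then show ?thesis
    unfolding c_def[symmetric] by (simp only: of_real_eq_iff)
qed simp

lemma Cauchy_Schwarz: "norm (ip x y) \<le> norm x * norm y"
proof (cases "y = 0")
  case False
  have "(norm (ip x y))\<^sup>2 / (norm y)\<^sup>2 \<le> (norm x)\<^sup>2"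
    using norm_minus_component[of x y] by (smt (verit) zero_le_power2)
  then have "(norm (ip x y))\<^sup>2 \<le> (norm x * norm y)\<^sup>2"
    using False by (simp add: field_simps power_mult_distrib)
  then show ?thesis
    by (rule power2_le_imp_le) simp
qed simp

lemma bounded_linear_ip_left: "bounded_linear (\<lambda>x. ip x y)"
  by (rule bounded_linear_intro[where K = "norm y"])
    (auto simp: ip_add_left ip_scaleR_left scaleR_conv_of_real Cauchy_Schwarz)

lemma bounded_linear_ip_right: "bounded_linear (ip x)"
  by (rule bounded_linear_intro[where K = "norm x"])
    (auto simp: ip_add_right ip_scaleR_right scaleR_conv_of_real Cauchy_Schwarz mult.commute
      intro: order_trans[OF Cauchy_Schwarz])

lemma norm_smul: "norm (smul c x) = norm c * norm x"
proof -
  have "(of_real ((norm (smul c x))\<^sup>2) :: 'k) = (c * sconj c) * ip x x"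
    by (simp only: ip_self[symmetric] ip_smul_left ip_smul_right ac_simps)
  also have "\<dots> = of_real ((norm c * norm x)\<^sup>2)"
    by (simp only: mult_sconj_of_real ip_self of_real_mult[symmetric] power_mult_distrib)
  finally have "(norm (smul c x))\<^sup>2 = (norm c * norm x)\<^sup>2"
    by (simp only: of_real_eq_iff)
  then show ?thesis by simp
qed

lemma bounded_linear_smul: "bounded_linear (smul c)"
proof (rule bounded_linear_intro[where K = "norm c"])
  show "smul c (r *\<^sub>R x) = r *\<^sub>R smul c x" for r x
    by (metis smul_of_real scale_left_commute)
qed (simp_all add: scale_right_distrib norm_smul mult.commute)

lemma parallelogram:
  fixes x y :: 'a
  shows "(norm (x + y))\<^sup>2 + (norm (x - y))\<^sup>2 = 2 * (norm x)\<^sup>2 + 2 * (norm y)\<^sup>2"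
proof -
  have "ip (x + y) (x + y) + ip (x - y) (x - y) = 2 * ip x x + 2 * ip y y"
    by (simp add: ip_add_left ip_add_right ip_diff_left ip_diff_right)
  then have "(of_real ((norm (x + y))\<^sup>2 + (norm (x - y))\<^sup>2) :: 'k)
      = of_real (2 * (norm x)\<^sup>2 + 2 * (norm y)\<^sup>2)"
    by (simp add: ip_self)
  then show ?thesis
    by (simp only: of_real_eq_iff)
qed


section \<open>Orthogonal projections\<close>

lemma subspace_scaleR: "subspace V \<Longrightarrow> v \<in> V \<Longrightarrow> r *\<^sub>R v \<in> V"
  by (metis subspace_scale smul_of_real)

text \<open>
  A sequence in \<open>V\<close> whose distances to \<open>f\<close> approach the infimum is Cauchy: its midpoints lie
  in \<open>V\<close>, hence not closer than the infimum, and the parallelogram law bounds the differences.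
\<close>

lemma closest_point_in_closed_subspace_exists:
  assumes V: "closed_subspace smul V"
  shows "\<exists>p\<in>V. \<forall>v\<in>V. norm (f - p) \<le> norm (f - v)"
proof -
  have sub: "subspace V" and "closed V"
    using V by (auto simp: closed_subspace_def)
  then have ne: "V \<noteq> {}"
    using subspace_0 by blast
  define d where "d = infdist f V"
  have d0: "0 \<le> d"
    by (simp add: d_def infdist_nonneg)
  have d_le: "d \<le> norm (f - v)" if "v \<in> V" for v
    using infdist_le[OF that, of f] by (simp add: d_def dist_norm)
  have "\<exists>v\<in>V. (norm (f - v))\<^sup>2 < d\<^sup>2 + 1 / real (Suc n)" for n
  proof -
    have "d < sqrt (d\<^sup>2 + 1 / real (Suc n))"
      by (rule real_less_rsqrt) simp
    moreover have "d = (INF a\<in>V. dist f a)"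
      using infdist_notempty[OF ne] by (simp add: d_def)
    ultimately obtain v where "v \<in> V" "dist f v < sqrt (d\<^sup>2 + 1 / real (Suc n))"
      using cINF_less_iff[OF ne, of "dist f"] by (metis bdd_below_image_dist)
    then have "(norm (f - v))\<^sup>2 < (sqrt (d\<^sup>2 + 1 / real (Suc n)))\<^sup>2"
      by (intro power_strict_mono) (auto simp: dist_norm)
    also have "\<dots> = d\<^sup>2 + 1 / real (Suc n)"
      by (rule real_sqrt_pow2) simp
    finally show ?thesis using \<open>v \<in> V\<close> by blast
  qed
  then obtain v where vV: "\<And>n. v n \<in> V"
    and v: "\<And>n. (norm (f - v n))\<^sup>2 < d\<^sup>2 + 1 / real (Suc n)"
    by metis
  have gap: "(norm (v m - v n))\<^sup>2 \<le> 2 / real (Suc m) + 2 / real (Suc n)" for m n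
  proof -
    have "(1/2) *\<^sub>R (v m + v n) \<in> V"
      using sub vV by (intro subspace_scaleR subspace_add)
    then have "d \<le> norm (f - (1/2) *\<^sub>R (v m + v n))"
      by (rule d_le)
    moreover have "(f - v m) + (f - v n) = 2 *\<^sub>R (f - (1/2) *\<^sub>R (v m + v n))"
      by (simp add: algebra_simps scaleR_2)
    ultimately have "2 * d \<le> norm ((f - v m) + (f - v n))"
      by simp
    then have "(2 * d)\<^sup>2 \<le> (norm ((f - v m) + (f - v n)))\<^sup>2"
      using d0 by (intro power_mono) auto
    moreover have "(norm ((f - v m) - (f - v n)))\<^sup>2 = (norm (v m - v n))\<^sup>2"
      by (simp add: norm_minus_commute)
    ultimately show ?thesis
      using parallelogram[of "f - v m" "f - v n"] v[of m] v[of n]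
      by (simp add: power_mult_distrib)
  qed
  have "Cauchy v"
  proof (rule CauchyI)
    fix e :: real assume "e > 0"
    then obtain N where N: "4 / e\<^sup>2 < real N"
      using reals_Archimedean2 by blast
    have "norm (v m - v n) < e" if "m \<ge> N" "n \<ge> N" for m n
    proof -
      have N0: "0 < real N"
        using N \<open>e > 0\<close> by (smt (verit) divide_nonneg_nonneg zero_le_power2)
      have "2 / real (Suc m) \<le> 2 / real N" "2 / real (Suc n) \<le> 2 / real N"
        using that N0 by (auto intro!: divide_left_mono)
      then have "(norm (v m - v n))\<^sup>2 \<le> 4 / real N"
        using gap[of m n] by simp
      also have "\<dots> < e\<^sup>2"
        using N N0 \<open>e > 0\<close> by (simp add: field_simps)
      finally show ?thesis
        using \<open>e > 0\<close> by (simp add: power2_less_imp_less)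
    qed
    then show "\<exists>N. \<forall>m\<ge>N. \<forall>n\<ge>N. norm (v m - v n) < e" by blast
  qed
  then obtain p where p: "v \<longlonglongrightarrow> p"
    using Cauchy_convergent convergentD by blast
  have "p \<in> V"
    using closed_sequentially[OF \<open>closed V\<close> _ p] vV by blast
  have "(\<lambda>n. d\<^sup>2 + 1 / real (Suc n)) \<longlonglongrightarrow> d\<^sup>2 + 0"
    by (intro tendsto_add tendsto_const LIMSEQ_Suc[OF lim_1_over_n])
  then have "(norm (f - p))\<^sup>2 \<le> d\<^sup>2"
    using v by (intro LIMSEQ_le[where X = "\<lambda>n. (norm (f - v n))\<^sup>2"])
      (auto intro!: tendsto_intros p less_imp_le)
  then have "norm (f - p) \<le> d"
    using d0 by (rule power2_le_imp_le)
  then show ?thesis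
    using \<open>p \<in> V\<close> d_le by force
qed

lemma orth_proj_ex1:
  assumes V: "closed_subspace smul V"
  shows "\<exists>!p. p \<in> V \<and> (\<forall>v\<in>V. ip (f - p) v = 0)"
proof -
  have sub: "subspace V"
    using V by (auto simp: closed_subspace_def)
  obtain p where p: "p \<in> V" and min: "\<And>v. v \<in> V \<Longrightarrow> norm (f - p) \<le> norm (f - v)"
    using closest_point_in_closed_subspace_exists[OF V] by blast
  have "ip (f - p) v = 0" if "v \<in> V" for v
  proof (cases "v = 0")
    case False
    define c where "c = ip (f - p) v / of_real ((norm v)\<^sup>2)"
    have "norm (f - p) \<le> norm (f - p - smul c v)"
      using min[of "p + smul c v"] sub p that
      by (simp add: subspace_add subspace_scale diff_diff_eq)
    then have "(norm (f - p))\<^sup>2 \<le> (norm (f - p - smul c v))\<^sup>2"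
      by (rule power_mono) simp
    then have "(norm (ip (f - p) v))\<^sup>2 / (norm v)\<^sup>2 \<le> 0"
      unfolding c_def norm_minus_component by simp
    then show ?thesis
      using False by (simp add: divide_le_0_iff)
  qed simp
  moreover have "q = p" if q: "q \<in> V" "\<forall>v\<in>V. ip (f - q) v = 0" for q
  proof -
    have "q - p \<in> V"
      using sub q(1) p by (rule subspace_diff)
    then have "ip (f - p) (q - p) - ip (f - q) (q - p) = 0"
      using q(2) calculation by simp
    then have "ip (q - p) (q - p) = 0"
      by (simp add: ip_diff_left)
    then show ?thesis
      by (simp add: ip_self_eq_0_iff)
  qed
  ultimately show ?thesis using p by blast
qed

lemma
  assumes "closed_subspace smul V"
  shows orth_proj_mem: "orth_proj ip V f \<in> V"
    and orth_proj_orth: "v \<in> V \<Longrightarrow> ip (f - orth_proj ip V f) v = 0"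
  using theI'[OF orth_proj_ex1[OF assms, of f]] unfolding orth_proj_def by blast+

lemma orth_proj_eqI:
  assumes "closed_subspace smul V" "p \<in> V" "\<And>v. v \<in> V \<Longrightarrow> ip (f - p) v = 0"
  shows "orth_proj ip V f = p"
  unfolding orth_proj_def
  by (rule the1_equality[OF orth_proj_ex1[OF assms(1)]]) (use assms in auto)

lemma orth_proj_add:
  assumes V: "closed_subspace smul V"
  shows "orth_proj ip V (f + g) = orth_proj ip V f + orth_proj ip V g"
proof (rule orth_proj_eqI[OF V])
  show "orth_proj ip V f + orth_proj ip V g \<in> V"
    using V orth_proj_mem[OF V] by (simp add: closed_subspace_def subspace_add)
  fix v assume "v \<in> V"
  then show "ip (f + g - (orth_proj ip V f + orth_proj ip V g)) v = 0"
    using orth_proj_orth[OF V, of v f] orth_proj_orth[OF V, of v g]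
    by (simp add: ip_diff_left ip_add_left)
qed

lemma orth_proj_smul:
  assumes V: "closed_subspace smul V"
  shows "orth_proj ip V (smul c f) = smul c (orth_proj ip V f)"
proof (rule orth_proj_eqI[OF V])
  show "smul c (orth_proj ip V f) \<in> V"
    using V orth_proj_mem[OF V] by (simp add: closed_subspace_def subspace_scale)
  fix v assume "v \<in> V"
  then show "ip (smul c f - smul c (orth_proj ip V f)) v = 0"
    using orth_proj_orth[OF V, of v f]
    by (simp add: ip_diff_left ip_smul_left)
qed

lemma ip_orth_proj_left:
  assumes V: "closed_subspace smul V"
  shows "ip (orth_proj ip V f) g = ip (orth_proj ip V f) (orth_proj ip V g)"
  using ip_eq_0_commute[OF orth_proj_orth[OF V orth_proj_mem[OF V], of g f]]
  by (simp add: ip_diff_right)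

lemma ip_orth_proj_right:
  assumes V: "closed_subspace smul V"
  shows "ip f (orth_proj ip V g) = ip (orth_proj ip V f) (orth_proj ip V g)"
  by (metis V ip_orth_proj_left ip_sconj)


section \<open>Adjoints\<close>

text \<open>
  The kernel of \<open>\<phi>\<close> is a closed subspace of codimension at most one, so \<open>\<phi>\<close> is determined by its
  value at a vector \<open>z\<close> orthogonal to the kernel, and the representing vector is the multiple of
  \<open>z\<close> that gives this value.
\<close>

lemma Riesz_representation:
  fixes \<phi> :: "'a \<Rightarrow> 'k"
  assumes bl: "bounded_linear \<phi>" and smul: "\<And>c x. \<phi> (smul c x) = c * \<phi> x"
  shows "\<exists>y. \<forall>x. \<phi> x = ip x y"
proof (cases "\<forall>x. \<phi> x = 0")
  case True
  then show ?thesis by (intro exI[of _ 0]) simp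
next
  case False
  interpret bounded_linear \<phi> by (fact bl)
  obtain u where u: "\<phi> u \<noteq> 0" using False by blast
  define N where "N = {x. \<phi> x = 0}"
  have "closed N"
    unfolding N_def
    by (intro closed_Collect_eq linear_continuous_on bl continuous_on_const)
  then have N: "closed_subspace smul N"
    by (auto simp: closed_subspace_def subspace_def N_def add smul)
  define z where "z = u - orth_proj ip N u"
  have "\<phi> z = \<phi> u"
    using orth_proj_mem[OF N, of u] by (simp add: z_def diff N_def)
  with u have z: "\<phi> z \<noteq> 0" by simp
  then have "z \<noteq> 0" by auto
  have "\<phi> x = ip x (smul (sconj (\<phi> z) / of_real ((norm z)\<^sup>2)) z)" for x
  proof -
    \<comment> \<open>Subtracting a multiple of \<open>z\<close> moves \<open>x\<close> into the kernel, to which \<open>z\<close> is orthogonal.\<close>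
    have "x - smul (\<phi> x / \<phi> z) z \<in> N"
      using z by (simp add: N_def diff smul)
    then have "ip z (x - smul (\<phi> x / \<phi> z) z) = 0"
      unfolding z_def by (rule orth_proj_orth[OF N])
    then have "ip (x - smul (\<phi> x / \<phi> z) z) z = 0"
      by (rule ip_eq_0_commute)
    then have "ip x z = \<phi> x / \<phi> z * of_real ((norm z)\<^sup>2)"
      by (simp add: ip_diff_left ip_smul_left ip_self)
    moreover have "sconj (sconj (\<phi> z) / of_real ((norm z)\<^sup>2)) = \<phi> z / of_real ((norm z)\<^sup>2)"
    proof -
      have "sconj (sconj (\<phi> z) / of_real ((norm z)\<^sup>2))
          = sconj (sconj (\<phi> z) * of_real (1 / (norm z)\<^sup>2))"
        by (simp add: divide_inverse)
      also have "\<dots> = \<phi> z * of_real (1 / (norm z)\<^sup>2)"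
        by (simp only: sconj_mult sconj_sconj sconj_of_real)
      finally show ?thesis by (simp add: divide_inverse)
    qed
    ultimately show ?thesis
      using z \<open>z \<noteq> 0\<close> by (simp only: ip_smul_right) simp
  qed
  then show ?thesis by blast
qed

lemma bounded_op_iff:
  "bounded_op smul T \<longleftrightarrow> bounded_linear T \<and> (\<forall>c x. T (smul c x) = smul c (T x))"
  unfolding bounded_op_def Vector_Spaces.linear_iff
  using vector_space_axioms by (auto simp: linear_simps(1))

lemma hadjoint_eqI:
  assumes "\<And>x y. ip (T x) y = ip x (T' y)"
  shows "hadjoint ip T = T'"
  unfolding hadjoint_def
proof (rule the_equality)
  show "\<forall>x y. ip (T x) y = ip x (T' y)" using assms by blast
  show "R = T'" if "\<forall>x y. ip (T x) y = ip x (R y)" for R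
  proof (rule ext, rule ip_right_eqI)
    show "ip x (R y) = ip x (T' y)" for x y
      using assms that by metis
  qed
qed

lemma ip_hadjoint:
  assumes T: "bounded_op smul T"
  shows "ip (T x) y = ip x (hadjoint ip T y)"
proof -
  have bl: "bounded_linear T" and smul: "\<And>c x. T (smul c x) = smul c (T x)"
    using T by (auto simp: bounded_op_iff)
  have "\<exists>w. \<forall>x. ip (T x) y = ip x w" for y
    by (rule Riesz_representation)
      (auto simp: smul ip_smul_left intro: bounded_linear_compose[OF bounded_linear_ip_left bl])
  then obtain T' where T': "\<And>x y. ip (T x) y = ip x (T' y)"
    by metis
  then show ?thesis
    using hadjoint_eqI[of T T'] by simp
qed

lemma ip_hadjoint_left:
  assumes T: "bounded_op smul T"
  shows "ip (hadjoint ip T x) y = ip x (T y)"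
  using ip_hadjoint[OF T, of y x] by (metis ip_sconj)

lemma bounded_op_hadjoint:
  assumes T: "bounded_op smul T"
  shows "bounded_op smul (hadjoint ip T)"
proof -
  let ?T = "hadjoint ip T"
  obtain C where C: "\<And>x. norm (T x) \<le> norm x * C"
    using T bounded_linear.bounded by (auto simp: bounded_op_def)
  have smul: "?T (smul c x) = smul c (?T x)" for c x
    by (rule ip_right_eqI) (simp add: ip_hadjoint[OF T, symmetric] ip_smul_right)
  have "bounded_linear ?T"
  proof (rule bounded_linear_intro)
    show "?T (x + y) = ?T x + ?T y" for x y
      by (rule ip_right_eqI) (simp add: ip_hadjoint[OF T, symmetric] ip_add_right)
    show "?T (r *\<^sub>R x) = r *\<^sub>R ?T x" for r x
      by (metis smul smul_of_real)
    show "norm (?T y) \<le> norm y * C" for y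
    proof (cases "?T y = 0")
      case True
      have "0 \<le> norm y * C" using C[of y] norm_ge_zero order_trans by blast
      with True show ?thesis by simp
    next
      case False
      have "norm (?T y) * norm (?T y) = norm (ip (?T y) (?T y))"
        by (simp only: ip_self norm_of_real) (simp add: power2_eq_square)
      also have "\<dots> = norm (ip (T (?T y)) y)"
        by (simp add: ip_hadjoint[OF T])
      also have "\<dots> \<le> norm (T (?T y)) * norm y"
        by (rule Cauchy_Schwarz)
      also have "\<dots> \<le> norm (?T y) * C * norm y"
        by (intro mult_right_mono C) simp
      finally have "norm (?T y) * norm (?T y) \<le> norm (?T y) * (norm y * C)"
        by (simp add: ac_simps)
      then show ?thesis using False by simp
    qed
  qed
  with smul show ?thesis by (simp add: bounded_op_iff)
qed

lemma self_adjointI: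
  assumes "bounded_op smul T" "\<And>x y. ip (T x) y = ip x (T y)"
  shows "self_adjoint smul ip T"
  using assms hadjoint_eqI by (simp add: self_adjoint_def)

lemma self_adjoint_scaled_comp_hadjoint:
  assumes T: "bounded_op smul T"
  shows "self_adjoint smul ip (\<lambda>f. A *\<^sub>R T (hadjoint ip T f))"
proof (rule self_adjointI)
  let ?T = "hadjoint ip T"
  have T': "bounded_op smul ?T" by (rule bounded_op_hadjoint[OF T])
  have "bounded_linear (\<lambda>f. A *\<^sub>R T (?T f))"
    using T T' unfolding bounded_op_def
    by (intro bounded_linear_compose[OF bounded_linear_scaleR_right]
        bounded_linear_compose[of T ?T]) auto
  moreover have "A *\<^sub>R T (?T (smul c x)) = smul c (A *\<^sub>R T (?T x))" for c x
    using T T' by (simp add: bounded_op_iff smul_of_real[symmetric] scale_left_commute)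
  ultimately show "bounded_op smul (\<lambda>f. A *\<^sub>R T (?T f))"
    by (simp add: bounded_op_iff)
  show "ip (A *\<^sub>R T (?T x)) y = ip x (A *\<^sub>R T (?T y))" for x y
    by (simp add: ip_scaleR_left ip_scaleR_right ip_hadjoint[OF T] ip_hadjoint_left[OF T, symmetric])
qed

lemma ip_comp_hadjoint_self:
  assumes T: "bounded_op smul T"
  shows "ip (T (hadjoint ip T f)) f = of_real ((norm (hadjoint ip T f))\<^sup>2)"
  by (simp only: ip_hadjoint[OF T] ip_self)

end


section \<open>The frame operator of a Bessel fusion sequence\<close>

text \<open>
  The bound makes the partial sums of \<open>f\<close> Cauchy, because the sums of \<open>g\<close> over finite sets
  that avoid a suitable finite set are small. Absolute summability of \<open>f\<close> does not follow.
\<close>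

lemma summable_on_if_sum_norm_sq_le:
  fixes f :: "'i \<Rightarrow> 'b::banach" and g :: "'i \<Rightarrow> real"
  assumes g: "g summable_on A" and g0: "\<And>i. i \<in> A \<Longrightarrow> 0 \<le> g i" and "0 \<le> C"
    and le: "\<And>F. finite F \<Longrightarrow> F \<subseteq> A \<Longrightarrow> (norm (sum f F))\<^sup>2 \<le> C * sum g F"
  shows "f summable_on A"
proof -
  have "\<exists>P. eventually P (finite_subsets_at_top A) \<and>
      (\<forall>F F'. P F \<and> P F' \<longrightarrow> dist (sum f F) (sum f F') < e)" if "e > 0" for e
  proof -
    define d where "d = (e/3)\<^sup>2 / (C + 1)"
    have "d > 0" using \<open>0 \<le> C\<close> \<open>e > 0\<close> by (simp add: d_def)
    then obtain F0 where F0: "finite F0" "F0 \<subseteq> A" "dist (sum g F0) (infsum g A) \<le> d"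
      using infsum_finite_approximation[OF g] by blast
    have tail: "norm (sum f F) \<le> e/3" if F: "finite F" "F \<subseteq> A" "F \<inter> F0 = {}" for F
    proof -
      have "sum g F0 + sum g F = sum g (F0 \<union> F)"
        using F F0 by (subst sum.union_disjoint) auto
      also have "\<dots> \<le> infsum g A"
        using F F0 g0 by (intro finite_sum_le_infsum[OF g]) auto
      finally have "sum g F \<le> d"
        using F0(3) by (simp add: dist_real_def)
      then have "(norm (sum f F))\<^sup>2 \<le> C * d"
        using le[OF F(1,2)] \<open>0 \<le> C\<close> by (meson mult_left_mono order_trans)
      also have "\<dots> \<le> (C + 1) * d" using \<open>d > 0\<close> by simp
      also have "\<dots> = (e/3)\<^sup>2" using \<open>0 \<le> C\<close> by (simp add: d_def)
      finally show ?thesis by (rule power2_le_imp_le) (use \<open>e > 0\<close> in simp)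
    qed
    define P where "P F \<longleftrightarrow> finite F \<and> F0 \<subseteq> F \<and> F \<subseteq> A" for F
    have "eventually P (finite_subsets_at_top A)"
      unfolding eventually_finite_subsets_at_top
      using F0 by (intro exI[of _ F0]) (auto simp: P_def)
    moreover have "dist (sum f F) (sum f F') < e" if "P F" "P F'" for F F'
    proof -
      have fin: "finite F" "finite F'" using that by (auto simp: P_def)
      have "sum f F - sum f F' = sum f (F - F') - sum f (F' - F)"
        using sum.Int_Diff[OF fin(1), of f F'] sum.Int_Diff[OF fin(2), of f F]
        by (simp add: Int_commute)
      moreover have "norm (sum f (F - F')) \<le> e/3" "norm (sum f (F' - F)) \<le> e/3"
        by (rule tail; use that in \<open>auto simp: P_def\<close>)+
      ultimately show ?thesis
        using norm_triangle_ineq4[of "sum f (F - F')" "sum f (F' - F)"] \<open>e > 0\<close>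
        by (simp add: dist_norm)
    qed
    ultimately show ?thesis by blast
  qed
  then have "cauchy_filter (filtermap (sum f) (finite_subsets_at_top A))"
    by (simp add: cauchy_filter_metric_filtermap)
  moreover have "complete (UNIV :: 'b set)"
    by (meson Cauchy_convergent UNIV_I complete_def convergent_def)
  ultimately obtain s where "(sum f \<longlongrightarrow> s) (finite_subsets_at_top A)"
    using complete_uniform[where S = UNIV] by (force simp: filterlim_def)
  then show ?thesis
    unfolding summable_on_def has_sum_def by blast
qed

context hilbert_space
begin

lemma bessel_bound_pos:
  assumes "bessel_fusion_sequence smul ip I W \<omega>"
  obtains B where "B > 0"
    "\<And>f. (\<Sum>\<^sub>\<infinity>i\<in>I. (\<omega> i)\<^sup>2 * (norm (orth_proj ip (W i) f))\<^sup>2) \<le> B * (norm f)\<^sup>2"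
proof -
  obtain B where B: "\<And>f. (\<Sum>\<^sub>\<infinity>i\<in>I. (\<omega> i)\<^sup>2 * (norm (orth_proj ip (W i) f))\<^sup>2) \<le> B * (norm f)\<^sup>2"
    using assms by (auto simp: bessel_fusion_sequence_def)
  have "B * (norm f)\<^sup>2 \<le> max B 1 * (norm f)\<^sup>2" for f :: 'a
    by (intro mult_right_mono) auto
  then show ?thesis
    using that[of "max B 1"] B by (meson less_max_iff_disj order_trans zero_less_one)
qed

text \<open>
  Test the vector \<open>u\<close> given by the sum against itself: its squared norm is the sum of the inner
  products of the projections of \<open>f\<close> and \<open>u\<close>, which the Cauchy-Schwarz inequality for sums
  separates into the sum for \<open>f\<close> and the sum for \<open>u\<close>; the latter is at most \<open>B * (norm u)\<^sup>2\<close>.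
\<close>

lemma norm_sum_weighted_proj_sq_le:
  assumes W: "\<And>i. i \<in> F \<Longrightarrow> closed_subspace smul (W i)" and "0 \<le> B"
    and B: "\<And>f. (\<Sum>i\<in>F. (\<omega> i)\<^sup>2 * (norm (orth_proj ip (W i) f))\<^sup>2) \<le> B * (norm f)\<^sup>2"
  shows "(norm (\<Sum>i\<in>F. (\<omega> i)\<^sup>2 *\<^sub>R orth_proj ip (W i) f))\<^sup>2
    \<le> B * (\<Sum>i\<in>F. (\<omega> i)\<^sup>2 * (norm (orth_proj ip (W i) f))\<^sup>2)"
proof -
  define u where "u = (\<Sum>i\<in>F. (\<omega> i)\<^sup>2 *\<^sub>R orth_proj ip (W i) f)"
  define E where "E h = (\<Sum>i\<in>F. (\<omega> i)\<^sup>2 * (norm (orth_proj ip (W i) h))\<^sup>2)" for h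
  have E0: "0 \<le> E h" for h
    unfolding E_def by (intro sum_nonneg) auto
  have "ip u u = (\<Sum>i\<in>F. of_real ((\<omega> i)\<^sup>2) * ip (orth_proj ip (W i) f) u)"
    by (subst (1) u_def) (simp only: ip_sum_left ip_scaleR_left)
  also have "\<dots> = (\<Sum>i\<in>F. of_real ((\<omega> i)\<^sup>2) * ip (orth_proj ip (W i) f) (orth_proj ip (W i) u))"
    using ip_orth_proj_left[OF W, of _ f u] by (intro sum.cong) auto
  finally have u: "ip u u = \<dots>" .
  have "(norm u)\<^sup>2 = norm (ip u u)"
    by (simp only: ip_self norm_of_real) simp
  also have "\<dots> \<le> (\<Sum>i\<in>F. (\<omega> i * norm (orth_proj ip (W i) f)) * (\<omega> i * norm (orth_proj ip (W i) u)))"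
    unfolding u
  proof (rule sum_norm_le)
    fix i assume "i \<in> F"
    have "norm (of_real ((\<omega> i)\<^sup>2) * ip (orth_proj ip (W i) f) (orth_proj ip (W i) u))
        = (\<omega> i)\<^sup>2 * norm (ip (orth_proj ip (W i) f) (orth_proj ip (W i) u))"
      by (simp only: norm_mult norm_of_real) simp
    also have "\<dots> \<le> (\<omega> i)\<^sup>2 * (norm (orth_proj ip (W i) f) * norm (orth_proj ip (W i) u))"
      by (intro mult_left_mono Cauchy_Schwarz) simp
    finally show "norm (of_real ((\<omega> i)\<^sup>2) * ip (orth_proj ip (W i) f) (orth_proj ip (W i) u))
        \<le> (\<omega> i * norm (orth_proj ip (W i) f)) * (\<omega> i * norm (orth_proj ip (W i) u))"
      by (simp add: power2_eq_square ac_simps)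
  qed
  finally have "((norm u)\<^sup>2)\<^sup>2
      \<le> (\<Sum>i\<in>F. (\<omega> i * norm (orth_proj ip (W i) f)) * (\<omega> i * norm (orth_proj ip (W i) u)))\<^sup>2"
    by (rule power_mono) simp
  also have "\<dots> \<le> E f * E u"
    unfolding E_def power_mult_distrib[symmetric] by (rule Cauchy_Schwarz_ineq_sum)
  also have "\<dots> \<le> E f * (B * (norm u)\<^sup>2)"
    using B[of u] E0 by (intro mult_left_mono) (auto simp: E_def)
  finally have "(norm u)\<^sup>2 * (norm u)\<^sup>2 \<le> (norm u)\<^sup>2 * (B * E f)"
    by (simp add: power2_eq_square ac_simps)
  then have "u \<noteq> 0 \<Longrightarrow> (norm u)\<^sup>2 \<le> B * E f"
    by (rule mult_left_le_imp_le) simp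
  then have "(norm u)\<^sup>2 \<le> B * E f"
    using E0[of f] \<open>0 \<le> B\<close> by (cases "u = 0") auto
  then show ?thesis
    by (simp add: u_def E_def)
qed

lemma norm_sum_weighted_proj_le:
  assumes W: "\<And>i. i \<in> F \<Longrightarrow> closed_subspace smul (W i)" and "0 \<le> B"
    and B: "\<And>f. (\<Sum>i\<in>F. (\<omega> i)\<^sup>2 * (norm (orth_proj ip (W i) f))\<^sup>2) \<le> B * (norm f)\<^sup>2"
  shows "norm (\<Sum>i\<in>F. (\<omega> i)\<^sup>2 *\<^sub>R orth_proj ip (W i) f) \<le> B * norm f"
proof (rule power2_le_imp_le)
  have "B * (\<Sum>i\<in>F. (\<omega> i)\<^sup>2 * (norm (orth_proj ip (W i) f))\<^sup>2) \<le> B * (B * (norm f)\<^sup>2)"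
    using \<open>0 \<le> B\<close> by (intro mult_left_mono B)
  then show "(norm (\<Sum>i\<in>F. (\<omega> i)\<^sup>2 *\<^sub>R orth_proj ip (W i) f))\<^sup>2 \<le> (B * norm f)\<^sup>2"
    using norm_sum_weighted_proj_sq_le[where f = f, OF assms]
    by (simp add: power2_eq_square ac_simps)
qed (use \<open>0 \<le> B\<close> in simp)

context
  fixes I :: "'i set" and W :: "'i \<Rightarrow> 'a set" and \<omega> :: "'i \<Rightarrow> real"
  assumes bessel: "bessel_fusion_sequence smul ip I W \<omega>"
begin

lemma bessel_closed_subspace: "i \<in> I \<Longrightarrow> closed_subspace smul (W i)"
  using bessel by (auto simp: bessel_fusion_sequence_def)

lemma bessel_summable: "(\<lambda>i. (\<omega> i)\<^sup>2 * (norm (orth_proj ip (W i) f))\<^sup>2) summable_on I"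
  using bessel by (auto simp: bessel_fusion_sequence_def)

lemma bessel_finite_bound:
  obtains B where "B > 0"
    "\<And>F f. finite F \<Longrightarrow> F \<subseteq> I \<Longrightarrow>
      (\<Sum>i\<in>F. (\<omega> i)\<^sup>2 * (norm (orth_proj ip (W i) f))\<^sup>2) \<le> B * (norm f)\<^sup>2"
proof -
  obtain B where B: "B > 0"
    "\<And>f. (\<Sum>\<^sub>\<infinity>i\<in>I. (\<omega> i)\<^sup>2 * (norm (orth_proj ip (W i) f))\<^sup>2) \<le> B * (norm f)\<^sup>2"
    using bessel_bound_pos[OF bessel] by blast
  have "(\<Sum>i\<in>F. (\<omega> i)\<^sup>2 * (norm (orth_proj ip (W i) f))\<^sup>2) \<le> B * (norm f)\<^sup>2"
    if "finite F" "F \<subseteq> I" for F f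
    using that by (intro order_trans[OF finite_sum_le_infsum[OF bessel_summable] B(2)]) auto
  with B(1) show ?thesis using that by blast
qed

lemma has_sum_fusion_frame_op:
  "((\<lambda>i. (\<omega> i)\<^sup>2 *\<^sub>R orth_proj ip (W i) f) has_sum fusion_frame_op ip I W \<omega> f) I"
proof -
  obtain B where B: "B > 0"
    "\<And>F f. finite F \<Longrightarrow> F \<subseteq> I \<Longrightarrow>
      (\<Sum>i\<in>F. (\<omega> i)\<^sup>2 * (norm (orth_proj ip (W i) f))\<^sup>2) \<le> B * (norm f)\<^sup>2"
    using bessel_finite_bound by blast
  have "(\<lambda>i. (\<omega> i)\<^sup>2 *\<^sub>R orth_proj ip (W i) f) summable_on I"
  proof (rule summable_on_if_sum_norm_sq_le[OF bessel_summable])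
    fix F assume F: "finite F" "F \<subseteq> I"
    show "(norm (\<Sum>i\<in>F. (\<omega> i)\<^sup>2 *\<^sub>R orth_proj ip (W i) f))\<^sup>2
        \<le> B * (\<Sum>i\<in>F. (\<omega> i)\<^sup>2 * (norm (orth_proj ip (W i) f))\<^sup>2)"
      by (rule norm_sum_weighted_proj_sq_le) (use F B bessel_closed_subspace in auto)
  qed (use B in auto)
  then show ?thesis
    by (simp add: fusion_frame_op_def)
qed

lemma bounded_op_fusion_frame_op: "bounded_op smul (fusion_frame_op ip I W \<omega>)"
proof -
  let ?S = "fusion_frame_op ip I W \<omega>"
  let ?g = "\<lambda>f i. (\<omega> i)\<^sup>2 *\<^sub>R orth_proj ip (W i) f"
  obtain B where B: "B > 0"
    "\<And>F f. finite F \<Longrightarrow> F \<subseteq> I \<Longrightarrow>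
      (\<Sum>i\<in>F. (\<omega> i)\<^sup>2 * (norm (orth_proj ip (W i) f))\<^sup>2) \<le> B * (norm f)\<^sup>2"
    using bessel_finite_bound by blast
  have smul: "?S (smul c f) = smul c (?S f)" for c f
  proof -
    from has_sum_bounded_linear[OF bounded_linear_smul has_sum_fusion_frame_op, of c f]
    have "((\<lambda>i. smul c (?g f i)) has_sum smul c (?S f)) I" .
    moreover have "smul c (?g f i) = ?g (smul c f) i" if "i \<in> I" for i
      using orth_proj_smul[OF bessel_closed_subspace[OF that], of c f]
      by (metis smul_of_real scale_left_commute)
    ultimately have "(?g (smul c f) has_sum smul c (?S f)) I"
      by (subst has_sum_cong[symmetric]) auto
    then show ?thesis
      using has_sum_fusion_frame_op has_sum_unique by blast
  qed
  have "bounded_linear ?S"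
  proof (rule bounded_linear_intro)
    fix f h :: 'a and r :: real
    have "((\<lambda>i. ?g f i + ?g h i) has_sum (?S f + ?S h)) I"
      by (intro has_sum_add has_sum_fusion_frame_op)
    moreover have "?g f i + ?g h i = ?g (f + h) i" if "i \<in> I" for i
      using orth_proj_add[OF bessel_closed_subspace[OF that], of f h]
      by (simp add: scaleR_right_distrib)
    ultimately have "(?g (f + h) has_sum (?S f + ?S h)) I"
      by (subst has_sum_cong[symmetric]) auto
    then show "?S (f + h) = ?S f + ?S h"
      using has_sum_fusion_frame_op has_sum_unique by blast
    show "?S (r *\<^sub>R f) = r *\<^sub>R ?S f"
      by (metis smul smul_of_real)
    have "(sum (?g f) \<longlongrightarrow> ?S f) (finite_subsets_at_top I)"
      using has_sum_fusion_frame_op by (simp add: has_sum_def)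
    then have "((\<lambda>F. norm (sum (?g f) F)) \<longlongrightarrow> norm (?S f)) (finite_subsets_at_top I)"
      by (rule tendsto_norm)
    moreover have "norm (sum (?g f) F) \<le> norm f * B" if F: "finite F" "F \<subseteq> I" for F
      unfolding mult.commute[of "norm f"]
      by (rule norm_sum_weighted_proj_le) (use F B bessel_closed_subspace in auto)
    ultimately show "norm (?S f) \<le> norm f * B"
      by (rule tendsto_upperbound[OF _ eventually_finite_subsets_at_top_weakI]) simp_all
  qed
  with smul show ?thesis by (simp add: bounded_op_iff)
qed

lemma has_sum_ip_fusion_frame_op_left:
  "((\<lambda>i. of_real ((\<omega> i)\<^sup>2) * ip (orth_proj ip (W i) f) (orth_proj ip (W i) g))
    has_sum ip (fusion_frame_op ip I W \<omega> f) g) I"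
proof -
  have eq: "ip ((\<omega> i)\<^sup>2 *\<^sub>R orth_proj ip (W i) f) g
      = of_real ((\<omega> i)\<^sup>2) * ip (orth_proj ip (W i) f) (orth_proj ip (W i) g)" if "i \<in> I" for i
    by (simp only: ip_scaleR_left ip_orth_proj_left[OF bessel_closed_subspace[OF that], of f g])
  have "((\<lambda>i. ip ((\<omega> i)\<^sup>2 *\<^sub>R orth_proj ip (W i) f) g) has_sum
      ip (fusion_frame_op ip I W \<omega> f) g) I"
    by (rule has_sum_bounded_linear[OF bounded_linear_ip_left has_sum_fusion_frame_op])
  also have "?this \<longleftrightarrow> ?thesis"
    by (rule has_sum_cong) (rule eq)
  finally show ?thesis .
qed

lemma has_sum_ip_fusion_frame_op_right:
  "((\<lambda>i. of_real ((\<omega> i)\<^sup>2) * ip (orth_proj ip (W i) f) (orth_proj ip (W i) g))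
    has_sum ip f (fusion_frame_op ip I W \<omega> g)) I"
proof -
  have eq: "ip f ((\<omega> i)\<^sup>2 *\<^sub>R orth_proj ip (W i) g)
      = of_real ((\<omega> i)\<^sup>2) * ip (orth_proj ip (W i) f) (orth_proj ip (W i) g)" if "i \<in> I" for i
    by (simp only: ip_scaleR_right ip_orth_proj_right[OF bessel_closed_subspace[OF that], of f g])
  have "((\<lambda>i. ip f ((\<omega> i)\<^sup>2 *\<^sub>R orth_proj ip (W i) g)) has_sum
      ip f (fusion_frame_op ip I W \<omega> g)) I"
    by (rule has_sum_bounded_linear[OF bounded_linear_ip_right has_sum_fusion_frame_op])
  also have "?this \<longleftrightarrow> ?thesis"
    by (rule has_sum_cong) (rule eq)
  finally show ?thesis .
qed

lemma self_adjoint_fusion_frame_op: "self_adjoint smul ip (fusion_frame_op ip I W \<omega>)"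
  by (rule self_adjointI[OF bounded_op_fusion_frame_op])
    (rule has_sum_unique[OF has_sum_ip_fusion_frame_op_left has_sum_ip_fusion_frame_op_right])

lemma ip_fusion_frame_op_self:
  "ip (fusion_frame_op ip I W \<omega> f) f
    = of_real (\<Sum>\<^sub>\<infinity>i\<in>I. (\<omega> i)\<^sup>2 * (norm (orth_proj ip (W i) f))\<^sup>2)"
proof (rule has_sum_unique)
  show "((\<lambda>i. of_real ((\<omega> i)\<^sup>2) * ip (orth_proj ip (W i) f) (orth_proj ip (W i) f))
      has_sum ip (fusion_frame_op ip I W \<omega> f) f) I"
    by (rule has_sum_ip_fusion_frame_op_left)
  show "((\<lambda>i. of_real ((\<omega> i)\<^sup>2) * ip (orth_proj ip (W i) f) (orth_proj ip (W i) f))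
      has_sum of_real (\<Sum>\<^sub>\<infinity>i\<in>I. (\<omega> i)\<^sup>2 * (norm (orth_proj ip (W i) f))\<^sup>2)) I"
    unfolding ip_self of_real_mult[symmetric]
    by (intro has_sum_bounded_linear[OF bounded_linear_of_real] has_sum_infsum bessel_summable)
qed

text \<open>
  Both operators are self-adjoint, so the operator inequality only says that the quadratic form of
  the difference is nonnegative, and the two quadratic forms are the two sides of the lower frame
  inequality.
\<close>

lemma op_le_fusion_frame_op_iff:
  assumes K: "bounded_op smul K"
  shows "op_le smul ip (\<lambda>f. A *\<^sub>R K (hadjoint ip K f)) (fusion_frame_op ip I W \<omega>) \<longleftrightarrow>
    (\<forall>f. A * (norm (hadjoint ip K f))\<^sup>2 \<le> (\<Sum>\<^sub>\<infinity>i\<in>I. (\<omega> i)\<^sup>2 * (norm (orth_proj ip (W i) f))\<^sup>2))"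
proof -
  have "ip (fusion_frame_op ip I W \<omega> f - A *\<^sub>R K (hadjoint ip K f)) f
      = of_real ((\<Sum>\<^sub>\<infinity>i\<in>I. (\<omega> i)\<^sup>2 * (norm (orth_proj ip (W i) f))\<^sup>2)
          - A * (norm (hadjoint ip K f))\<^sup>2)" for f
    by (simp only: ip_diff_left ip_scaleR_left ip_fusion_frame_op_self
        ip_comp_hadjoint_self[OF K] of_real_diff of_real_mult)
  then show ?thesis
    using self_adjoint_scaled_comp_hadjoint[OF K] self_adjoint_fusion_frame_op
    by (simp only: op_le_def nonneg_Reals_of_real_iff diff_ge_0_iff_ge simp_thms)
qed

end

end

theorem proposition2p2:
  fixes smul :: "'k::rc_scalar \<Rightarrow> 'a::banach \<Rightarrow> 'a"
    and ip :: "'a \<Rightarrow> 'a \<Rightarrow> 'k"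
    and I :: "'i set"
    and W :: "'i \<Rightarrow> 'a set"
    and \<omega> :: "'i \<Rightarrow> real"
    and K :: "'a \<Rightarrow> 'a"
  assumes "hilbert_space smul ip"
    and "separable_space (euclidean :: 'a topology)"
    and "countable I"
    and "bessel_fusion_sequence smul ip I W \<omega>"
    and "bounded_op smul K"
    and "closed (range K)"
  shows "K_fusion_frame smul ip K I W \<omega> \<longleftrightarrow>
    (\<exists>A::real. A > 0 \<and>
      op_le smul ip (\<lambda>f. A *\<^sub>R K (hadjoint ip K f)) (fusion_frame_op ip I W \<omega>))"
proof -
  interpret hilbert_space smul ip by fact
  note bessel = \<open>bessel_fusion_sequence smul ip I W \<omega>\<close>
  note op_le_iff = op_le_fusion_frame_op_iff[OF bessel \<open>bounded_op smul K\<close>]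
  obtain B where "B > 0"
    "\<And>f. (\<Sum>\<^sub>\<infinity>i\<in>I. (\<omega> i)\<^sup>2 * (norm (orth_proj ip (W i) f))\<^sup>2) \<le> B * (norm f)\<^sup>2"
    using bessel_bound_pos[OF bessel] by blast
  moreover have "\<forall>i\<in>I. closed_subspace smul (W i) \<and> \<omega> i > 0"
    using bessel by (simp add: bessel_fusion_sequence_def)
  ultimately show ?thesis
    unfolding op_le_iff K_fusion_frame_def using bessel_summable[OF bessel] by blast
qed

end
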